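(* Let $m$ be a positive integer and let $\lambda\in\mathbb{Z}_m^{(\mathbb{Z})}$. If $S_\lambda\colon\mathbb{Z}_m^{(\mathbb{Z})}\to\mathbb{Z}_m^{(\mathbb{Z})}$ is the finitary linear cellular automaton associated with $\lambda$, then its Pontryagin dual is $\widehat{S_\lambda}=T_{\lambda^\wedge}$. Consequently, if $T_\lambda\colon\mathbb{Z}_m^{\mathbb{Z}}\to\mathbb{Z}_m^{\mathbb{Z}}$ is the linear cellular automaton associated with $\lambda$, then $\widehat{T_\lambda}=S_{\lambda^\wedge}$. In case $\lambda$ is symmetric (that is, $\lambda^\wedge=\lambda$), $\widehat{S_\lambda}=T_\lambda$ and $\widehat{T_\lambda}=S_\lambda$.
   Context: $\mathbb{Z}_m=\mathbb{Z}/m\mathbb{Z}$ is discrete; $K=\mathbb{Z}_m^{\mathbb{Z}}$ is the compact abelian group (product topology) of all $x=(x_n)_{n\in\mathbb{Z}}$ with entries in $\mathbb{Z}_m$; $L=\mathbb{Z}_m^{(\mathbb{Z})}$ is its subgroup of finitely supported elements, regarded as a discrete abelian group. For $\lambda\in\mathbb{Z}_m^{(\mathbb{Z})}$, the (one-dimensional) linear cellular automaton $T_\lambda\colon K\to K$ is defined by $(T_\lambda(x))_n=\sum_{i\in\mathbb{Z}}\lambda_i x_{n+i}$ for all $n\in\mathbb{Z}$, and the finitary linear cellular automaton $S_\lambda\colon L\to L$ is the restriction of $T_\lambda$ to $L$. Put $\lambda^\wedge:=(\lambda_{-n})_{n\in\mathbb{Z}}$. For a locally compact abelian group $G$, $\widehat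 G$ is its Pontryagin dual (continuous homomorphisms $G\to\mathbb{T}=\mathbb{R}/\mathbb{Z}$, with the compact-open topology), and for a continuous endomorphism $\phi\colon G\to G$ the dual $\widehat\phi\colon\widehat G\to\widehat G$ is $\widehat\phi(\chi)=\chi\circ\phi$. Identify $\mathbb{Z}_m$ with the subgroup of $\mathbb{T}$ of elements killed by $m$ (via $a\mapsto a/m+\mathbb{Z}$). The groups $\widehat K$ and $\widehat L$ are identified with $L$ and $K$ respectively through the pairing $\langle a\mid x\rangle=\sum_{i\in\mathbb{Z}}a_ix_i\in\mathbb{Z}_m\leq\mathbb{T}$ for $a\in L$, $x\in K$: $a\in L$ is identified with the character $x\mapsto\langle a\mid x\rangle$ of $K$, and $x\in K$ with the character $a\mapsto\langle a\mid x\rangle$ of $L$. *)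

theory Defs
  imports "HOL-Analysis.Analysis" "HOL-Algebra.Elementary_Groups" "HOL-Algebra.Product_Groups"
begin

section \<open>The circle group \<open>\<real>/\<int>\<close>\<close>

definition real_group :: "real monoid" where
  "real_group = \<lparr>carrier = UNIV, monoid.mult = (+), one = 0\<rparr>"

definition circle_group :: "real set monoid" where
  "circle_group = real_group Mod \<int>"

definition circle_proj :: "real \<Rightarrow> real set" where
  "circle_proj t = \<int> #>\<^bsub>real_group\<^esub> t"

text \<open>The quotient topology with respect to \<^const>\<open>circle_proj\<close>.\<close>
definition circle_topology :: "real set topology" where
  "circle_topology =
     topology (\<lambda>U. U \<subseteq> carrier circle_group \<and> open (circle_proj -` U))"

lemma openin_circle_topology:
  "openin circle_topology U \<longleftrightarrow> U \<subseteq> carrier circle_group \<and> open (circle_proj -` U)"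
proof -
  have "istopology (\<lambda>U. U \<subseteq> carrier circle_group \<and> open (circle_proj -` U))"
    by (auto simp: istopology_def vimage_Union)
  then show ?thesis
    by (simp add: circle_topology_def)
qed


section \<open>Pontryagin duality\<close>

text \<open>A topological abelian group is given by a group \<open>G\<close> together with a topology \<open>X\<close> on
  \<open>carrier G\<close>. Characters are made \<^const>\<open>extensional\<close>, so that two of them are equal as soon as
  they agree on \<open>carrier G\<close>; the same applies to all maps between groups below.\<close>

definition dual_group :: "('a, 'c) monoid_scheme \<Rightarrow> 'a topology \<Rightarrow> ('a \<Rightarrow> real set) monoid" where
  "dual_group G X =
     \<lparr>carrier = {\<theta> \<in> extensional (carrier G).
                  \<theta> \<in> hom G circle_group \<and> continuous_map X circle_topology \<theta>},
      monoid.mult = (\<lambda>\<theta> \<eta>. \<lambda>g\<in>carrier G. \<theta> g \<otimes>\<^bsub>circle_group\<^esub> \<eta> g),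
      one = (\<lambda>g\<in>carrier G. \<one>\<^bsub>circle_group\<^esub>)\<rparr>"

text \<open>The compact-open topology.\<close>
definition dual_topology :: "('a, 'c) monoid_scheme \<Rightarrow> 'a topology \<Rightarrow> ('a \<Rightarrow> real set) topology" where
  "dual_topology G X =
     subtopology
       (topology_generated_by
          {{\<theta>. \<theta> ` C \<subseteq> U} | C U. compactin X C \<and> openin circle_topology U})
       (carrier (dual_group G X))"

definition dual_map ::
    "('a, 'c) monoid_scheme \<Rightarrow> 'a topology \<Rightarrow> ('a \<Rightarrow> 'a) \<Rightarrow> ('a \<Rightarrow> real set) \<Rightarrow> ('a \<Rightarrow> real set)" where
  "dual_map G X \<phi> = (\<lambda>\<theta>\<in>carrier (dual_group G X). compose (carrier G) \<theta> \<phi>)"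

definition topological_group_iso ::
    "('a, 'c) monoid_scheme \<Rightarrow> 'a topology \<Rightarrow> ('b, 'd) monoid_scheme \<Rightarrow> 'b topology \<Rightarrow> ('a \<Rightarrow> 'b) \<Rightarrow> bool" where
  "topological_group_iso G X H Y f \<longleftrightarrow> f \<in> iso G H \<and> homeomorphic_map X Y f"

text \<open>If \<open>\<iota>\<close> is a bijection from \<open>A\<close> onto \<open>B\<close>, the self-map \<open>\<psi>\<close> of \<open>A\<close> becomes the self-map
  \<open>\<iota> \<circ> \<psi> \<circ> \<iota>\<^sup>-\<^sup>1\<close> of \<open>B\<close> once \<open>A\<close> and \<open>B\<close> are identified through \<open>\<iota>\<close>.\<close>
definition identified_map :: "'a set \<Rightarrow> 'b set \<Rightarrow> ('a \<Rightarrow> 'b) \<Rightarrow> ('a \<Rightarrow> 'a) \<Rightarrow> 'b \<Rightarrow> 'b" where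
  "identified_map A B \<iota> \<psi> = (\<lambda>b\<in>B. \<iota> (\<psi> (inv_into A \<iota> b)))"


section \<open>Linear cellular automata over \<open>\<int>/m\<int>\<close>\<close>

text \<open>For \<open>m > 0\<close> the residue classes modulo \<open>m\<close> are represented by \<open>{0..<m}\<close>, the carrier of
  \<^const>\<open>integer_mod_group\<close>; their products are formed in \<open>\<int>\<close> and reduced modulo \<open>m\<close>.\<close>

definition K_group :: "nat \<Rightarrow> (int \<Rightarrow> int) monoid" where
  "K_group m = product_group UNIV (\<lambda>_. integer_mod_group m)"

definition K_topology :: "nat \<Rightarrow> (int \<Rightarrow> int) topology" where
  "K_topology m =
     product_topology (\<lambda>_. discrete_topology (carrier (integer_mod_group m))) UNIV"

definition L_group :: "nat \<Rightarrow> (int \<Rightarrow> int) monoid" where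
  "L_group m = sum_group UNIV (\<lambda>_. integer_mod_group m)"

definition L_topology :: "nat \<Rightarrow> (int \<Rightarrow> int) topology" where
  "L_topology m = discrete_topology (carrier (L_group m))"

definition linear_CA :: "nat \<Rightarrow> (int \<Rightarrow> int) \<Rightarrow> (int \<Rightarrow> int) \<Rightarrow> (int \<Rightarrow> int)" where
  "linear_CA m l =
     (\<lambda>x\<in>carrier (K_group m). \<lambda>n. (\<Sum>i | l i \<noteq> 0. l i * x (n + i)) mod int m)"

definition finitary_linear_CA :: "nat \<Rightarrow> (int \<Rightarrow> int) \<Rightarrow> (int \<Rightarrow> int) \<Rightarrow> (int \<Rightarrow> int)" where
  "finitary_linear_CA m l = restrict (linear_CA m l) (carrier (L_group m))"

definition reflect :: "(int \<Rightarrow> int) \<Rightarrow> (int \<Rightarrow> int)" where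
  "reflect l = (\<lambda>n. l (- n))"

definition pairing :: "nat \<Rightarrow> (int \<Rightarrow> int) \<Rightarrow> (int \<Rightarrow> int) \<Rightarrow> int" where
  "pairing m a x = (\<Sum>i | a i \<noteq> 0. a i * x i) mod int m"

definition residue_to_circle :: "nat \<Rightarrow> int \<Rightarrow> real set" where
  "residue_to_circle m k = circle_proj (real_of_int k / real m)"

definition K_character :: "nat \<Rightarrow> (int \<Rightarrow> int) \<Rightarrow> (int \<Rightarrow> int) \<Rightarrow> real set" where
  "K_character m a = (\<lambda>x\<in>carrier (K_group m). residue_to_circle m (pairing m a x))"

definition L_character :: "nat \<Rightarrow> (int \<Rightarrow> int) \<Rightarrow> (int \<Rightarrow> int) \<Rightarrow> real set" where
  "L_character m x = (\<lambda>a\<in>carrier (L_group m). residue_to_circle m (pairing m a x))"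


text \<open>The cellular automata are continuous endomorphisms of \<open>K\<close> and \<open>L\<close>.\<close>

lemma carrier_K_group:
  assumes "m > 0"
  shows "carrier (K_group m) = {x. \<forall>i. x i \<in> {0..<int m}}"
  using assms by (auto simp: K_group_def carrier_integer_mod_group PiE_def Pi_def)

lemma carrier_L_group:
  assumes "m > 0"
  shows "carrier (L_group m) = {x \<in> carrier (K_group m). finite {i. x i \<noteq> 0}}"
  using assms by (auto simp: L_group_def K_group_def carrier_sum_group)

lemma mult_K_group: "x \<otimes>\<^bsub>K_group m\<^esub> y = (\<lambda>i. (x i + y i) mod int m)"
  by (simp add: K_group_def product_group_def restrict_UNIV)

lemma mult_L_group: "x \<otimes>\<^bsub>L_group m\<^esub> y = (\<lambda>i. (x i + y i) mod int m)"
  by (simp add: L_group_def sum_group_def product_group_def restrict_UNIV)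

lemma reflect_closed:
  assumes "m > 0" "l \<in> carrier (L_group m)"
  shows "reflect l \<in> carrier (L_group m)"
proof -
  have "{i. l (- i) \<noteq> 0} = uminus ` {i. l i \<noteq> 0}"
    by (force simp: image_iff intro: exI[of _ "- _"])
  with assms show ?thesis
    by (auto simp: carrier_L_group carrier_K_group reflect_def)
qed

lemma linear_CA_closed:
  assumes "m > 0" "x \<in> carrier (K_group m)"
  shows "linear_CA m l x \<in> carrier (K_group m)"
  using assms by (auto simp: linear_CA_def carrier_K_group)

lemma linear_CA_mult:
  assumes "m > 0" "x \<in> carrier (K_group m)" "y \<in> carrier (K_group m)"
  shows "linear_CA m l (x \<otimes>\<^bsub>K_group m\<^esub> y) = linear_CA m l x \<otimes>\<^bsub>K_group m\<^esub> linear_CA m l y"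
proof -
  have xy: "x \<otimes>\<^bsub>K_group m\<^esub> y \<in> carrier (K_group m)"
    using assms by (simp add: mult_K_group carrier_K_group)
  have "(\<Sum>i | l i \<noteq> 0. l i * ((x (n + i) + y (n + i)) mod int m)) mod int m
      = (\<Sum>i | l i \<noteq> 0. l i * x (n + i) + l i * y (n + i)) mod int m" for n
    by (subst (1 2) mod_sum_eq[symmetric]) (simp add: mod_mult_right_eq distrib_left)
  with assms xy show ?thesis
    by (simp add: linear_CA_def mult_K_group sum.distrib mod_add_eq)
qed

lemma linear_CA_hom:
  assumes "m > 0"
  shows "linear_CA m l \<in> hom (K_group m) (K_group m)"
  using assms by (auto simp: hom_def linear_CA_closed linear_CA_mult)

lemma linear_CA_continuous:
  assumes m: "m > 0" and l: "l \<in> carrier (L_group m)"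
  shows "continuous_map (K_topology m) (K_topology m) (linear_CA m l)"
proof -
  let ?Z = "discrete_topology (carrier (integer_mod_group m))"
  let ?D = "discrete_topology (UNIV :: int set)"
  have top: "topspace (K_topology m) = carrier (K_group m)"
    by (simp add: K_topology_def K_group_def)
  have coord: "continuous_map (K_topology m) ?D (\<lambda>x. x k)" for k
  proof -
    have "continuous_map (K_topology m) ?Z (\<lambda>x. x k)"
      unfolding K_topology_def by (rule continuous_map_product_projection) simp
    moreover have "continuous_map ?Z ?D id"
      by simp
    ultimately have "continuous_map (K_topology m) ?D (id \<circ> (\<lambda>x. x k))"
      by (rule continuous_map_compose)
    then show ?thesis by (simp add: o_def)
  qed
  have fin: "finite {i. l i \<noteq> 0}"
    using m l by (simp add: carrier_L_group)
  have "continuous_map (K_topology m) ?D (\<lambda>x. \<Sum>i\<in>I. l i * x (n + i))" if "finite I" for I n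
    using that
  proof induction
    case empty
    show ?case by simp
  next
    case (insert j I)
    have "continuous_map (K_topology m) (prod_topology ?D ?D)
            (\<lambda>x. (x (n + j), \<Sum>i\<in>I. l i * x (n + i)))"
      using coord insert.IH by (simp add: continuous_map_pairedI)
    moreover have "continuous_map (prod_topology ?D ?D) ?D (\<lambda>(u, v). l j * u + v)"
      by (simp flip: prod_topology_discrete_topology)
    ultimately have "continuous_map (K_topology m) ?D
        ((\<lambda>(u, v). l j * u + v) \<circ> (\<lambda>x. (x (n + j), \<Sum>i\<in>I. l i * x (n + i))))"
      by (rule continuous_map_compose)
    with insert.hyps show ?case by (simp add: o_def)
  qed
  note step = this
  from step[OF fin] have sums:
    "continuous_map (K_topology m) ?D (\<lambda>x. \<Sum>i | l i \<noteq> 0. l i * x (n + i))" for n .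
  have "continuous_map ?D ?Z (\<lambda>k. k mod int m)"
    using m by (auto simp: carrier_integer_mod_group)
  from continuous_map_compose[OF sums this]
  have "continuous_map (K_topology m) ?Z (\<lambda>x. (\<Sum>i | l i \<noteq> 0. l i * x (n + i)) mod int m)" for n
    by (simp add: o_def)
  then have "continuous_map (K_topology m) ?Z (\<lambda>x. linear_CA m l x n)" for n
    by (rule continuous_map_eq) (simp add: top linear_CA_def)
  then show ?thesis
    by (subst (2) K_topology_def) (simp add: continuous_map_componentwise_UNIV)
qed

lemma finitary_linear_CA_closed:
  assumes m: "m > 0" and l: "l \<in> carrier (L_group m)" and x: "x \<in> carrier (L_group m)"
  shows "finitary_linear_CA m l x \<in> carrier (L_group m)"
proof -
  have xK: "x \<in> carrier (K_group m)" and fx: "finite {i. x i \<noteq> 0}" and fl: "finite {i. l i \<noteq> 0}"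
    using m l x by (auto simp: carrier_L_group)
  have "{n. linear_CA m l x n \<noteq> 0} \<subseteq> (\<lambda>(k, i). k - i) ` ({i. x i \<noteq> 0} \<times> {i. l i \<noteq> 0})"
  proof
    fix n
    assume "n \<in> {n. linear_CA m l x n \<noteq> 0}"
    then have "(\<Sum>i | l i \<noteq> 0. l i * x (n + i)) \<noteq> 0"
      using xK by (auto simp: linear_CA_def)
    then obtain i where "l i \<noteq> 0" "x (n + i) \<noteq> 0"
      by (auto elim!: sum.not_neutral_contains_not_neutral)
    then show "n \<in> (\<lambda>(k, i). k - i) ` ({i. x i \<noteq> 0} \<times> {i. l i \<noteq> 0})"
      by (auto intro!: image_eqI[of _ _ "(n + i, i)"])
  qed
  then have "finite {n. linear_CA m l x n \<noteq> 0}"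
    by (rule finite_subset) (use fx fl in simp)
  then show ?thesis
    using m x linear_CA_closed[OF m xK] by (simp add: finitary_linear_CA_def carrier_L_group)
qed

lemma finitary_linear_CA_hom:
  assumes "m > 0" "l \<in> carrier (L_group m)"
  shows "finitary_linear_CA m l \<in> hom (L_group m) (L_group m)"
proof (rule homI)
  fix x y
  assume xy: "x \<in> carrier (L_group m)" "y \<in> carrier (L_group m)"
  then have "x \<otimes>\<^bsub>L_group m\<^esub> y \<in> carrier (L_group m)"
    unfolding L_group_def by (intro monoid.m_closed group.is_monoid sum_group) auto
  with xy assms show "finitary_linear_CA m l (x \<otimes>\<^bsub>L_group m\<^esub> y) =
      finitary_linear_CA m l x \<otimes>\<^bsub>L_group m\<^esub> finitary_linear_CA m l y"
    using linear_CA_mult[OF assms(1), of x y l]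
    by (simp add: finitary_linear_CA_def mult_L_group mult_K_group carrier_L_group)
qed (use assms finitary_linear_CA_closed in blast)

end

theory Submission
  imports Defs
begin

text \<open>
  Write \<open>e k\<close> for the class of \<open>k / m\<close> in the circle (\<open>residue_to_circle m k\<close>). It depends only on \<open>k\<close>
  modulo \<open>m\<close>, and every point killed by \<open>m\<close> has this form. As \<open>K\<close> and \<open>L\<close> are themselves killed by
  \<open>m\<close>, their characters take values among the \<open>e k\<close> only (\<open>torsion_image_residue\<close>). These finitely
  many points are separated by open arcs (\<open>residue_in_arc_iff\<close>), so that topological statements about
  characters reduce to congruences.

  The group \<open>L\<close> is generated by the elements supported at one position, and the value of a character
  at the generator at position \<open>i\<close> is \<open>e (x i)\<close> for an arbitrary residue \<open>x i\<close>; this gives the bijection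
  of \<open>K\<close> with the dual of \<open>L\<close> (\<open>hom_L_eq_L_character\<close>). A character of \<open>K\<close>
  restricts to a character of \<open>L\<close>, hence to some \<open>L_character m a\<close>. By continuity its kernel is open,
  because the kernel is the preimage of an arc around the identity; hence it contains all \<open>x\<close>
  vanishing on some finite set of positions. This forces \<open>a\<close> to be
  finitely supported and the character to be \<open>K_character m a\<close> (\<open>hom_K_eq_K_character\<close>).

  For the topologies, \<open>L_character\<close> is a continuous bijection from a compact space onto a Hausdorff
  space, hence a homeomorphism. On the other side the dual of the compact group \<open>K\<close> is discrete
  (\<open>dual_topology_K_discrete\<close>): a character \<open>K_character m a\<close> is determined among all characters by
  mapping each of the \<open>m\<close> compact level sets of \<open>pairing m a\<close> into the corresponding arc.

  Finally, exchanging two finite sums and substituting \<open>k = n + i\<close> shows that the adjoint of the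
  automaton with rule \<open>l\<close> is the automaton with the reflected rule (\<open>pairing_finitary_linear_CA\<close>).
  This one identity yields both dual maps, since reflection is an involution.
\<close>


section \<open>The circle group and its \<open>m\<close>-torsion\<close>

lemma comm_group_real_group: "comm_group real_group"
  by (rule comm_groupI)
    (auto simp: real_group_def add.commute add.left_commute intro: exI[of _ "- _"]
      | metis add.left_inverse)+

lemma normal_Ints: "\<int> \<lhd> real_group"
proof -
  interpret comm_group real_group by (rule comm_group_real_group)
  have inv: "inv\<^bsub>real_group\<^esub> x = - x" for x
    by (rule inv_equality) (auto simp: real_group_def)
  have "subgroup \<int> real_group"
    by (rule subgroupI) (auto simp: inv, auto simp: real_group_def intro: Ints_0)
  then show ?thesis
    by (rule subgroup_imp_normal)
qed

lemma group_circle: "group circle_group"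
  unfolding circle_group_def by (rule normal.factorgroup_is_group[OF normal_Ints])

lemma circle_proj_eq_iff: "circle_proj s = circle_proj t \<longleftrightarrow> s - t \<in> \<int>"
proof
  assume "circle_proj s = circle_proj t"
  moreover have "s \<in> circle_proj s"
    by (auto simp: circle_proj_def r_coset_def real_group_def intro: bexI[of _ 0])
  ultimately show "s - t \<in> \<int>"
    by (auto simp: circle_proj_def r_coset_def real_group_def)
next
  assume st: "s - t \<in> \<int>"
  have "z + s \<in> circle_proj t" "z + t \<in> circle_proj s" if "z \<in> \<int>" for z
    using that st Ints_add[OF that st] Ints_diff[OF that st]
    by (auto simp: circle_proj_def r_coset_def real_group_def
        intro: bexI[of _ "z + (s - t)"] bexI[of _ "z - (s - t)"])
  then show "circle_proj s = circle_proj t"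
    by (auto simp: circle_proj_def r_coset_def real_group_def)
qed

lemma carrier_circle_group: "carrier circle_group = range circle_proj"
  by (auto simp: circle_group_def circle_proj_def FactGroup_def RCOSETS_def real_group_def)

lemma circle_proj_mult: "circle_proj s \<otimes>\<^bsub>circle_group\<^esub> circle_proj t = circle_proj (s + t)"
  using normal.rcos_sum[OF normal_Ints, of s t]
  by (simp add: circle_group_def circle_proj_def FactGroup_def real_group_def)

lemma circle_proj_0: "circle_proj 0 = \<one>\<^bsub>circle_group\<^esub>"
  by (auto simp: circle_group_def circle_proj_def FactGroup_def r_coset_def real_group_def)

lemma circle_proj_pow: "circle_proj t [^]\<^bsub>circle_group\<^esub> (k::nat) = circle_proj (real k * t)"
  by (induction k) (simp_all add: circle_proj_0 circle_proj_mult algebra_simps)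

lemma topspace_circle_topology: "topspace circle_topology = carrier circle_group"
proof -
  have "openin circle_topology (carrier circle_group)"
    by (simp add: openin_circle_topology carrier_circle_group vimage_def)
  then show ?thesis
    by (auto simp: topspace_def openin_circle_topology)
qed

text \<open>The projection is an open map: the full preimage of the image of \<open>V\<close> is the union of the integer
  translates of \<open>V\<close>.\<close>
lemma openin_circle_proj_image:
  assumes "open V"
  shows "openin circle_topology (circle_proj ` V)"
proof -
  have "circle_proj -` circle_proj ` V = (\<Union>z\<in>\<int>. (+) z ` V)"
  proof (intro equalityI subsetI)
    fix s
    assume "s \<in> circle_proj -` circle_proj ` V"
    then obtain t where "t \<in> V" "s - t \<in> \<int>"
      by (auto simp: circle_proj_eq_iff)
    then show "s \<in> (\<Union>z\<in>\<int>. (+) z ` V)"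
      by (intro UN_I[of "s - t"] image_eqI[of _ _ t]) auto
  next
    fix s
    assume "s \<in> (\<Union>z\<in>\<int>. (+) z ` V)"
    then obtain z t where "z \<in> \<int>" "t \<in> V" "s = z + t" by auto
    then show "s \<in> circle_proj -` circle_proj ` V"
      using circle_proj_eq_iff[of s t] by simp
  qed
  then show ?thesis
    using assms by (auto simp: openin_circle_topology carrier_circle_group open_translation)
qed

lemma residue_to_circle_closed: "residue_to_circle m k \<in> carrier circle_group"
  by (simp add: residue_to_circle_def carrier_circle_group)

lemma residue_to_circle_add:
  "residue_to_circle m (j + k) = residue_to_circle m j \<otimes>\<^bsub>circle_group\<^esub> residue_to_circle m k"
  by (simp add: residue_to_circle_def circle_proj_mult add_divide_distrib)

lemma residue_to_circle_pow:
  "residue_to_circle m k [^]\<^bsub>circle_group\<^esub> (n::nat) = residue_to_circle m (int n * k)"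
  by (simp add: residue_to_circle_def circle_proj_pow)

lemma residue_to_circle_0: "residue_to_circle m 0 = \<one>\<^bsub>circle_group\<^esub>"
  by (simp add: residue_to_circle_def circle_proj_0)

lemma residue_to_circle_eq_iff:
  assumes "m > 0"
  shows "residue_to_circle m j = residue_to_circle m k \<longleftrightarrow> j mod int m = k mod int m"
proof -
  have "residue_to_circle m j = residue_to_circle m k \<longleftrightarrow>
      (\<exists>z. real_of_int j / real m - real_of_int k / real m = of_int z)"
    by (auto simp: residue_to_circle_def circle_proj_eq_iff elim!: Ints_cases)
  also have "\<dots> \<longleftrightarrow> (\<exists>z. real_of_int (j - k) = real_of_int (int m * z))"
    using assms by (simp add: field_simps)
  also have "\<dots> \<longleftrightarrow> int m dvd j - k"
    by (simp only: of_int_eq_iff dvd_def)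
  finally show ?thesis
    by (simp add: mod_eq_dvd_iff)
qed

lemma residue_to_circle_mod:
  "m > 0 \<Longrightarrow> residue_to_circle m (k mod int m) = residue_to_circle m k"
  by (simp add: residue_to_circle_eq_iff)

text \<open>The radius \<open>1 / m\<close> is the largest one for which the open interval around \<open>k / m\<close> omits the neighbouring
  multiples of \<open>1 / m\<close>.\<close>
definition residue_arc :: "nat \<Rightarrow> int \<Rightarrow> real set set" where
  "residue_arc m k = circle_proj ` ball (real_of_int k / real m) (1 / real m)"

lemma openin_residue_arc: "openin circle_topology (residue_arc m k)"
  unfolding residue_arc_def by (rule openin_circle_proj_image) simp

text \<open>If \<open>\<bar>k / m - (j / m - z)\<bar> < 1 / m\<close> with \<open>z\<close> an integer, then \<open>k - j + z m\<close> is an integer of absolute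
  value below 1, hence 0. Distinct arcs may overlap, but not in an \<open>m\<close>-torsion point.\<close>
lemma residue_in_arc_iff:
  assumes m: "m > 0"
  shows "residue_to_circle m j \<in> residue_arc m k \<longleftrightarrow> j mod int m = k mod int m"
proof
  assume "residue_to_circle m j \<in> residue_arc m k"
  then obtain t z where t: "\<bar>real_of_int k / m - t\<bar> < 1 / m" and z: "real_of_int j / m - t = of_int z"
    by (auto simp: residue_arc_def residue_to_circle_def circle_proj_eq_iff dist_real_def elim!: Ints_cases)
  have "t = (of_int j - of_int z * of_nat m) / m"
    using m z by (simp add: field_simps)
  with t have "\<bar>(of_int k - of_int j + of_int z * of_nat m) / real m\<bar> < 1 / m"
    by (simp add: diff_divide_distrib add_divide_distrib)
  then have "\<bar>real_of_int (k - j + z * int m)\<bar> < 1"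
    using m by (simp add: abs_divide divide_less_cancel)
  then have "k - j + z * int m = 0"
    by linarith
  then have "j = k + z * int m" by simp
  then show "j mod int m = k mod int m" by simp
next
  assume "j mod int m = k mod int m"
  then have "residue_to_circle m j = residue_to_circle m k"
    using m by (simp add: residue_to_circle_eq_iff)
  then show "residue_to_circle m j \<in> residue_arc m k"
    using m by (simp add: residue_arc_def residue_to_circle_def)
qed

text \<open>If \<open>h x\<close> is the class of \<open>t\<close>, then \<open>m t\<close> represents \<open>h (x\<^sup>m) = 1\<close> and is an integer, the required \<open>n\<close>.\<close>
lemma torsion_image_residue:
  assumes m: "m > 0" and G: "group G" and h: "h \<in> hom G circle_group"
    and x: "x \<in> carrier G" "x [^]\<^bsub>G\<^esub> m = \<one>\<^bsub>G\<^esub>"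
  shows "\<exists>n. h x = residue_to_circle m n"
proof -
  interpret group_hom G circle_group h
    using G h group_circle by (simp add: group_hom_def group_hom_axioms_def)
  have "h x \<in> carrier circle_group"
    using x by simp
  then obtain t where t: "h x = circle_proj t"
    by (auto simp: carrier_circle_group)
  have "circle_proj (real m * t) = h (x [^]\<^bsub>G\<^esub> m)"
    using x(1) t by (simp add: hom_nat_pow circle_proj_pow)
  also have "\<dots> = circle_proj 0"
    by (simp add: x(2) circle_proj_0)
  finally obtain n where "real m * t = of_int n"
    by (auto simp: circle_proj_eq_iff elim: Ints_cases)
  then have "t = of_int n / m"
    using m by (simp add: field_simps)
  with t show ?thesis
    by (auto simp: residue_to_circle_def)
qed


section \<open>The groups \<open>K\<close> and \<open>L\<close> and their pairing\<close>

lemma group_K: "group (K_group m)"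
  unfolding K_group_def by (rule product_group) simp

lemma group_L: "group (L_group m)"
  unfolding L_group_def by (rule sum_group) simp

lemma one_K: "\<one>\<^bsub>K_group m\<^esub> = (\<lambda>i. 0)"
  by (simp add: K_group_def product_group_def restrict_UNIV)

lemma one_L: "\<one>\<^bsub>L_group m\<^esub> = (\<lambda>i. 0)"
  by (simp add: L_group_def sum_group_def product_group_def restrict_UNIV)

lemma pow_K: "x [^]\<^bsub>K_group m\<^esub> (k::nat) = (\<lambda>i. int k * x i mod int m)"
  by (induction k) (auto simp: one_K mult_K_group mod_add_right_eq algebra_simps)

lemma pow_L: "x [^]\<^bsub>L_group m\<^esub> (k::nat) = (\<lambda>i. int k * x i mod int m)"
  by (induction k) (auto simp: one_L mult_L_group mod_add_right_eq algebra_simps)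

lemma topspace_K: "topspace (K_topology m) = carrier (K_group m)"
  by (simp add: K_topology_def K_group_def)

lemma topspace_L: "topspace (L_topology m) = carrier (L_group m)"
  by (simp add: L_topology_def)

lemma compact_space_K: "m > 0 \<Longrightarrow> compact_space (K_topology m)"
  by (auto simp: K_topology_def compact_space_product_topology compact_space_discrete_topology
      carrier_integer_mod_group)

text \<open>Summing over any finite superset of the support lets pairings of elements with different supports
  be compared over a common index set.\<close>
lemma residue_pairing:
  assumes m: "m > 0" and F: "finite F" "{i. a i \<noteq> 0} \<subseteq> F"
  shows "residue_to_circle m (pairing m a x) = residue_to_circle m (\<Sum>i\<in>F. a i * x i)"
proof -
  have "(\<Sum>i | a i \<noteq> 0. a i * x i) = (\<Sum>i\<in>F. a i * x i)"
    using F by (intro sum.mono_neutral_left) auto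
  then show ?thesis
    using m by (simp add: pairing_def residue_to_circle_mod)
qed

lemma residue_pairing_mult_left:
  assumes m: "m > 0" and a: "a \<in> carrier (L_group m)" and b: "b \<in> carrier (L_group m)"
  shows "residue_to_circle m (pairing m (a \<otimes>\<^bsub>L_group m\<^esub> b) x) =
    residue_to_circle m (pairing m a x) \<otimes>\<^bsub>circle_group\<^esub> residue_to_circle m (pairing m b x)"
proof -
  let ?F = "{i. a i \<noteq> 0} \<union> {i. b i \<noteq> 0}"
  have F: "finite ?F"
    using a b m by (simp add: carrier_L_group)
  have "(\<Sum>i\<in>?F. (a i + b i) mod int m * x i) mod int m = (\<Sum>i\<in>?F. a i * x i + b i * x i) mod int m"
    by (subst (1 2) mod_sum_eq[symmetric]) (simp add: mod_mult_left_eq distrib_right)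
  then have "residue_to_circle m (\<Sum>i\<in>?F. (a i + b i) mod int m * x i) =
      residue_to_circle m ((\<Sum>i\<in>?F. a i * x i) + (\<Sum>i\<in>?F. b i * x i))"
    using m by (simp add: residue_to_circle_eq_iff sum.distrib)
  moreover have "{i. (a i + b i) mod int m \<noteq> 0} \<subseteq> ?F"
    by auto
  ultimately show ?thesis
    using residue_pairing[OF m F, of a x] residue_pairing[OF m F, of b x]
      residue_pairing[OF m F, of "\<lambda>i. (a i + b i) mod int m" x]
    by (simp add: mult_L_group residue_to_circle_add)
qed

lemma pairing_eq_linear_CA:
  "x \<in> carrier (K_group m) \<Longrightarrow> pairing m a x = linear_CA m a x 0"
  by (simp add: pairing_def linear_CA_def)

lemma residue_pairing_mult_right:
  assumes m: "m > 0" and x: "x \<in> carrier (K_group m)" and y: "y \<in> carrier (K_group m)"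
  shows "residue_to_circle m (pairing m a (x \<otimes>\<^bsub>K_group m\<^esub> y)) =
    residue_to_circle m (pairing m a x) \<otimes>\<^bsub>circle_group\<^esub> residue_to_circle m (pairing m a y)"
proof -
  have "x \<otimes>\<^bsub>K_group m\<^esub> y \<in> carrier (K_group m)"
    using x y group_K by (simp add: group.is_monoid monoid.m_closed)
  then have "pairing m a (x \<otimes>\<^bsub>K_group m\<^esub> y) = (pairing m a x + pairing m a y) mod int m"
    using linear_CA_mult[OF m x y, of a] x y by (simp add: pairing_eq_linear_CA mult_K_group)
  then show ?thesis
    using m by (simp add: residue_to_circle_mod residue_to_circle_add)
qed

text \<open>Pairing with \<open>a\<close> is the coordinate at 0 of the automaton with rule \<open>a\<close>, so its continuity is inherited
  from that of the automaton.\<close>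
lemma continuous_map_pairing:
  assumes "m > 0" "a \<in> carrier (L_group m)"
  shows "continuous_map (K_topology m) (discrete_topology {0..<int m}) (pairing m a)"
proof -
  have "continuous_map (K_topology m) (discrete_topology (carrier (integer_mod_group m)))
      ((\<lambda>x. x 0) \<circ> linear_CA m a)"
    using linear_CA_continuous[OF assms] unfolding K_topology_def
    by (rule continuous_map_compose) (rule continuous_map_product_projection, simp)
  then have "continuous_map (K_topology m) (discrete_topology {0..<int m})
      (\<lambda>x. linear_CA m a x 0)"
    using assms by (simp add: carrier_integer_mod_group o_def)
  then show ?thesis
    by (rule continuous_map_eq) (simp add: topspace_K pairing_eq_linear_CA)
qed

text \<open>Reducing \<open>k\<close> modulo \<open>m\<close> keeps the value in \<open>{0..<m}\<close> also for \<open>k = 1\<close> and \<open>m = 1\<close>, where the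
  generator at \<open>i\<close> is 0.\<close>
definition residue_single :: "nat \<Rightarrow> int \<Rightarrow> int \<Rightarrow> int \<Rightarrow> int" where
  "residue_single m i k = (\<lambda>j. if j = i then k mod int m else 0)"

lemma residue_single_closed:
  assumes "m > 0"
  shows "residue_single m i k \<in> carrier (L_group m)"
proof -
  have "finite {j. residue_single m i k j \<noteq> 0}"
    by (rule finite_subset[of _ "{i}"]) (auto simp: residue_single_def)
  then show ?thesis
    using assms by (auto simp: carrier_L_group carrier_K_group residue_single_def)
qed

lemma residue_single_pow: "residue_single m i (int k) = residue_single m i 1 [^]\<^bsub>L_group m\<^esub> k"
  by (auto simp: residue_single_def pow_L mod_mult_right_eq)

lemma residue_pairing_single_left:
  assumes "m > 0"
  shows "residue_to_circle m (pairing m (residue_single m i 1) x) = residue_to_circle m (x i)"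
proof -
  have "residue_to_circle m (pairing m (residue_single m i 1) x) =
      residue_to_circle m (1 mod int m * x i)"
    by (subst residue_pairing[OF assms, of "{i}"]) (auto simp: residue_single_def)
  also have "\<dots> = residue_to_circle m (x i)"
    using assms by (simp add: residue_to_circle_eq_iff mod_mult_left_eq)
  finally show ?thesis .
qed

lemma pairing_sym:
  assumes "m > 0" "a \<in> carrier (L_group m)" "b \<in> carrier (L_group m)"
  shows "pairing m a b = pairing m b a"
proof -
  let ?F = "{i. a i \<noteq> 0} \<union> {i. b i \<noteq> 0}"
  have F: "finite ?F"
    using assms by (simp add: carrier_L_group)
  have "(\<Sum>i | a i \<noteq> 0. a i * b i) = (\<Sum>i\<in>?F. a i * b i)"
    using F by (intro sum.mono_neutral_left) auto
  moreover have "(\<Sum>i | b i \<noteq> 0. b i * a i) = (\<Sum>i\<in>?F. b i * a i)"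
    using F by (intro sum.mono_neutral_left) auto
  ultimately show ?thesis
    by (simp add: pairing_def mult.commute)
qed

text \<open>Both sides are congruent modulo \<open>m\<close> to the double sum over \<open>k\<close> and \<open>i\<close> of \<open>a k * l i * x (k - i)\<close>: on the left \<open>a\<close> is shifted,
  and \<open>k = n + i\<close> moves the shift to \<open>x\<close> with the opposite sign.\<close>
lemma pairing_finitary_linear_CA:
  assumes m: "m > 0" and l: "l \<in> carrier (L_group m)"
    and a: "a \<in> carrier (L_group m)" and x: "x \<in> carrier (K_group m)"
  shows "pairing m (finitary_linear_CA m l a) x = pairing m a (linear_CA m (reflect l) x)"
proof -
  define A I where "A = {k. a k \<noteq> 0}" and "I = {i. l i \<noteq> 0}"
  define F where "F = (\<lambda>(k, i). k - i) ` (A \<times> I)"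
  have fin: "finite A" "finite I" "finite F"
    using m l a by (auto simp: carrier_L_group A_def I_def F_def)
  have S: "finitary_linear_CA m l a n = (\<Sum>i\<in>I. l i * a (n + i)) mod int m" for n
    using m a by (simp add: finitary_linear_CA_def linear_CA_def carrier_L_group I_def)
  have T: "linear_CA m (reflect l) x k = (\<Sum>i\<in>I. l i * x (k - i)) mod int m" for k
  proof -
    have "(\<Sum>i | reflect l i \<noteq> 0. reflect l i * x (k + i)) = (\<Sum>i\<in>I. l i * x (k - i))"
      by (rule sum.reindex_bij_witness[of _ uminus uminus]) (auto simp: reflect_def I_def)
    then show ?thesis
      using x by (simp add: linear_CA_def)
  qed
  have supp: "{n. finitary_linear_CA m l a n \<noteq> 0} \<subseteq> F"
  proof
    fix n
    assume "n \<in> {n. finitary_linear_CA m l a n \<noteq> 0}"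
    then have "(\<Sum>i\<in>I. l i * a (n + i)) \<noteq> 0"
      by (auto simp: S)
    then obtain i where "i \<in> I" "a (n + i) \<noteq> 0"
      by (auto elim!: sum.not_neutral_contains_not_neutral)
    then show "n \<in> F"
      by (auto simp: F_def A_def intro!: image_eqI[of _ _ "(n + i, i)"])
  qed
  have shift: "(\<Sum>n\<in>F. a (n + i) * x n) = (\<Sum>k\<in>A. a k * x (k - i))" if "i \<in> I" for i
  proof -
    have "(\<Sum>n\<in>F. a (n + i) * x n) = (\<Sum>n\<in>(\<lambda>k. k - i) ` A. a (n + i) * x n)"
      using fin that by (intro sum.mono_neutral_right) (force simp: F_def A_def)+
    also have "\<dots> = (\<Sum>k\<in>A. a k * x (k - i))"
      by (subst sum.reindex) (auto simp: inj_on_def)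
    finally show ?thesis .
  qed
  have "pairing m (finitary_linear_CA m l a) x =
      (\<Sum>n\<in>F. (\<Sum>i\<in>I. l i * a (n + i)) mod int m * x n) mod int m"
    using fin supp unfolding pairing_def
    by (subst sum.mono_neutral_left[where T = F]) (auto simp: S)
  also have "\<dots> = (\<Sum>n\<in>F. (\<Sum>i\<in>I. l i * a (n + i)) * x n) mod int m"
    by (subst (1 2) mod_sum_eq[symmetric]) (simp add: mod_mult_left_eq)
  also have "(\<Sum>n\<in>F. (\<Sum>i\<in>I. l i * a (n + i)) * x n) =
      (\<Sum>i\<in>I. l i * (\<Sum>n\<in>F. a (n + i) * x n))"
    unfolding sum_distrib_left sum_distrib_right by (subst sum.swap) (simp add: mult.assoc)
  also have "\<dots> = (\<Sum>i\<in>I. l i * (\<Sum>k\<in>A. a k * x (k - i)))"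
    by (simp add: shift)
  also have "\<dots> = (\<Sum>k\<in>A. a k * (\<Sum>i\<in>I. l i * x (k - i)))"
    unfolding sum_distrib_left by (subst sum.swap) (simp add: mult.left_commute)
  also have "\<dots> mod int m = (\<Sum>k\<in>A. a k * linear_CA m (reflect l) x k) mod int m"
    unfolding T by (subst (1 2) mod_sum_eq[symmetric]) (simp add: mod_mult_right_eq)
  also have "\<dots> = pairing m a (linear_CA m (reflect l) x)"
    by (simp add: pairing_def A_def)
  finally show ?thesis .
qed


section \<open>Characters of \<open>L\<close> and of \<open>K\<close>\<close>

lemma L_character_in_dual:
  assumes m: "m > 0" and x: "x \<in> carrier (K_group m)"
  shows "L_character m x \<in> carrier (dual_group (L_group m) (L_topology m))"
proof -
  have "L_character m x \<in> hom (L_group m) circle_group"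
    using m group_L[of m]
    by (auto simp: hom_def L_character_def residue_to_circle_closed residue_pairing_mult_left
        group.is_monoid monoid.m_closed)
  then show ?thesis
    by (auto simp: dual_group_def L_topology_def topspace_circle_topology hom_def)
      (simp add: L_character_def)
qed

lemma K_character_in_dual:
  assumes m: "m > 0" and a: "a \<in> carrier (L_group m)"
  shows "K_character m a \<in> carrier (dual_group (K_group m) (K_topology m))"
proof -
  have "K_character m a \<in> hom (K_group m) circle_group"
    using m group_K[of m]
    by (auto simp: hom_def K_character_def residue_to_circle_closed residue_pairing_mult_right
        group.is_monoid monoid.m_closed)
  moreover have "continuous_map (K_topology m) circle_topology (K_character m a)"
  proof -
    have "continuous_map (discrete_topology {0..<int m}) circle_topology (residue_to_circle m)"
      by (auto simp: topspace_circle_topology residue_to_circle_closed)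
    from continuous_map_compose[OF continuous_map_pairing[OF m a] this]
    show ?thesis
      by (rule continuous_map_eq) (simp add: topspace_K K_character_def)
  qed
  ultimately show ?thesis
    by (simp add: dual_group_def) (simp add: K_character_def)
qed

text \<open>A homomorphism on \<open>L\<close> is determined by the residues \<open>x i\<close> describing its values on the generators;
  building an element up one position at a time shows that it is the pairing with \<open>x\<close>.\<close>
lemma hom_L_eq_L_character:
  assumes m: "m > 0" and h: "h \<in> hom (L_group m) circle_group"
  shows "\<exists>x\<in>carrier (K_group m). \<forall>a\<in>carrier (L_group m). h a = L_character m x a"
proof -
  interpret group_hom "L_group m" circle_group h
    using group_L group_circle h by (simp add: group_hom_def group_hom_axioms_def)
  have "\<exists>n. h (residue_single m i 1) = residue_to_circle m n" for i
    by (rule torsion_image_residue[OF m group_L h])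
      (simp_all add: residue_single_closed m flip: residue_single_pow, simp add: residue_single_def one_L fun_eq_iff)
  then obtain n where n: "h (residue_single m i 1) = residue_to_circle m (n i)" for i
    by metis
  define x where "x = (\<lambda>i. n i mod int m)"
  have x: "x \<in> carrier (K_group m)"
    using m by (simp add: x_def carrier_K_group)
  have single: "h (residue_single m i (a i)) = residue_to_circle m (a i * x i)"
    if "a \<in> carrier (L_group m)" for a i
  proof -
    have "a i = int (nat (a i))"
      using m that by (simp add: carrier_L_group carrier_K_group)
    then have "h (residue_single m i (a i)) = h (residue_single m i 1) [^]\<^bsub>circle_group\<^esub> nat (a i)"
      using hom_nat_pow[OF residue_single_closed[OF m]] residue_single_pow by metis
    also have "\<dots> = residue_to_circle m (a i * n i)"
      using \<open>a i = int (nat (a i))\<close> by (simp add: n residue_to_circle_pow)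
    also have "\<dots> = residue_to_circle m (a i * x i)"
      using m by (simp add: residue_to_circle_eq_iff x_def mod_mult_right_eq)
    finally show ?thesis .
  qed
  have "h a = L_character m x a" if a: "a \<in> carrier (L_group m)" for a
  proof -
    have ai: "a i mod int m = a i" for i
      using a m by (simp add: carrier_L_group carrier_K_group)
    have part: "h (\<lambda>i. if i \<in> F then a i else 0) = residue_to_circle m (\<Sum>i\<in>F. a i * x i)"
      if "finite F" for F
      using that
    proof induction
      case empty
      then show ?case
        using hom_one by (simp add: one_L residue_to_circle_0)
    next
      case (insert j F)
      have "finite {i. (if i \<in> F then a i else 0) \<noteq> 0}"
        using insert.hyps(1) by (rule rev_finite_subset) auto
      then have F: "(\<lambda>i. if i \<in> F then a i else 0) \<in> carrier (L_group m)"
        using a m by (simp add: carrier_L_group carrier_K_group)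
      have "(\<lambda>i. if i \<in> insert j F then a i else 0) =
          residue_single m j (a j) \<otimes>\<^bsub>L_group m\<^esub> (\<lambda>i. if i \<in> F then a i else 0)"
        using insert.hyps(2) by (auto simp: mult_L_group residue_single_def ai)
      then have "h (\<lambda>i. if i \<in> insert j F then a i else 0) =
          residue_to_circle m (a j * x j) \<otimes>\<^bsub>circle_group\<^esub> residue_to_circle m (\<Sum>i\<in>F. a i * x i)"
        by (simp only: hom_mult[OF residue_single_closed[OF m] F] single[OF a] insert.IH)
      then show ?case
        using insert.hyps by (simp add: residue_to_circle_add)
    qed
    have F: "finite {i. a i \<noteq> 0}"
      using a m by (simp add: carrier_L_group)
    have "(\<lambda>i. if i \<in> {i. a i \<noteq> 0} then a i else 0) = a"
      by auto
    with part[OF F] residue_pairing[OF m F subset_refl, of x] a show ?thesis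
      by (simp add: L_character_def)
  qed
  with x show ?thesis by blast
qed

text \<open>Continuity yields a finite set \<open>F\<close> of positions such that the homomorphism kills every element
  vanishing on \<open>F\<close>. It therefore factors through finitely many coordinates, where the description of the
  homomorphisms on \<open>L\<close> applies.\<close>
lemma hom_K_eq_K_character:
  assumes m: "m > 0" and h: "h \<in> hom (K_group m) circle_group"
    and cont: "continuous_map (K_topology m) circle_topology h"
  shows "\<exists>a\<in>carrier (L_group m). \<forall>x\<in>carrier (K_group m). h x = K_character m a x"
proof -
  interpret group_hom "K_group m" circle_group h
    using group_K group_circle h by (simp add: group_hom_def group_hom_axioms_def)
  have LK: "x \<in> carrier (K_group m)" if "x \<in> carrier (L_group m)" for x
    using that m by (simp add: carrier_L_group)
  define V where "V = {x \<in> topspace (K_topology m). h x \<in> residue_arc m 0}"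
  have "openin (K_topology m) V"
    unfolding V_def by (rule openin_continuous_map_preimage[OF cont openin_residue_arc])
  moreover have "(\<lambda>i. 0) \<in> V"
  proof -
    have "(\<lambda>i. 0) \<in> carrier (K_group m)"
      using m by (simp add: carrier_K_group)
    moreover have "h (\<lambda>i. 0) = residue_to_circle m 0"
      using hom_one by (simp add: one_K residue_to_circle_0)
    ultimately show ?thesis
      using m by (simp add: V_def topspace_K residue_in_arc_iff)
  qed
  ultimately obtain W where "finite {i \<in> UNIV. W i \<noteq> topspace (discrete_topology (carrier (integer_mod_group m)))}"
    and W0: "(\<lambda>i. 0) \<in> PiE UNIV W" and WV: "PiE UNIV W \<subseteq> V"
    unfolding K_topology_def openin_product_topology_alt by metis
  then have fin: "finite {i. W i \<noteq> carrier (integer_mod_group m)}"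
    by simp
  \<comment> \<open>A basic open neighbourhood of 0 restricts only the coordinates in \<open>F\<close>.\<close>
  define F where "F = {i. W i \<noteq> carrier (integer_mod_group m)}"
  have kernel: "h x = \<one>\<^bsub>circle_group\<^esub>" if x: "x \<in> carrier (K_group m)" and 0: "\<And>i. i \<in> F \<Longrightarrow> x i = 0" for x
  proof -
    have "x i \<in> W i" for i
      using x 0[of i] W0 m
      by (cases "i \<in> F") (auto simp: F_def PiE_iff carrier_K_group carrier_integer_mod_group)
    then have "x \<in> V"
      using WV by (auto simp: PiE_iff)
    then have arc: "h x \<in> residue_arc m 0"
      by (simp add: V_def)
    obtain n where n: "h x = residue_to_circle m n"
      using torsion_image_residue[OF m group_K h x] by (auto simp: pow_K one_K)
    with arc show ?thesis
      using m by (simp add: residue_in_arc_iff residue_to_circle_eq_iff flip: residue_to_circle_0[of m])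
  qed
  have hL: "h \<in> hom (L_group m) circle_group"
    using hom_mult by (auto simp: hom_def LK mult_L_group mult_K_group)
  obtain a where aK: "a \<in> carrier (K_group m)"
    and ha: "\<And>x. x \<in> carrier (L_group m) \<Longrightarrow> h x = L_character m a x"
    using hom_L_eq_L_character[OF m hL] by blast
  \<comment> \<open>The generators outside \<open>F\<close> lie in the kernel, so \<open>a\<close> vanishes there.\<close>
  have aF: "{i. a i \<noteq> 0} \<subseteq> F"
  proof (rule ccontr)
    assume "\<not> {i. a i \<noteq> 0} \<subseteq> F"
    then obtain i where i: "a i \<noteq> 0" "i \<notin> F" by auto
    let ?s = "residue_single m i 1"
    have s: "?s \<in> carrier (L_group m)"
      by (rule residue_single_closed[OF m])
    have "h ?s = \<one>\<^bsub>circle_group\<^esub>"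
      by (rule kernel[OF LK[OF s]]) (use i in \<open>auto simp: residue_single_def\<close>)
    then have "residue_to_circle m (a i) = residue_to_circle m 0"
      using ha[OF s] s by (simp add: L_character_def residue_pairing_single_left[OF m] residue_to_circle_0)
    then show False
      using i aK m by (simp add: residue_to_circle_eq_iff carrier_K_group)
  qed
  have finF: "finite F"
    using fin by (simp add: F_def)
  have a: "a \<in> carrier (L_group m)"
    using m aK finite_subset[OF aF finF] by (simp add: carrier_L_group)
  have "h x = K_character m a x" if x: "x \<in> carrier (K_group m)" for x
  proof -
    define y where "y = (\<lambda>i. if i \<in> F then x i else 0)"
    define z where "z = (\<lambda>i. if i \<in> F then 0 else x i)"
    have yz: "y \<in> carrier (K_group m)" "z \<in> carrier (K_group m)"
      using x m by (auto simp: y_def z_def carrier_K_group)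
    have yF: "{i. y i \<noteq> 0} \<subseteq> F"
      by (auto simp: y_def)
    have y: "y \<in> carrier (L_group m)"
      using yz m finite_subset[OF yF finF] by (simp add: carrier_L_group)
    have "x = y \<otimes>\<^bsub>K_group m\<^esub> z"
      using x m by (auto simp: mult_K_group y_def z_def carrier_K_group)
    then have "h x = h y"
      using yz kernel[OF yz(2)] hom_mult[OF yz] by (simp add: z_def)
    also have "\<dots> = residue_to_circle m (\<Sum>i\<in>F. a i * y i)"
      using ha[OF y] y residue_pairing[OF m finF yF, of a]
      by (simp add: L_character_def mult.commute)
    also have "(\<Sum>i\<in>F. a i * y i) = (\<Sum>i\<in>F. a i * x i)"
      by (simp add: y_def)
    also have "residue_to_circle m (\<Sum>i\<in>F. a i * x i) = K_character m a x"
      using x residue_pairing[OF m finF aF, of x] by (simp add: K_character_def)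
    finally show ?thesis .
  qed
  with a show ?thesis by blast
qed

lemma inj_on_L_character:
  assumes m: "m > 0"
  shows "inj_on (L_character m) (carrier (K_group m))"
proof (intro inj_onI ext)
  fix x y i
  assume xy: "x \<in> carrier (K_group m)" "y \<in> carrier (K_group m)"
    and eq: "L_character m x = L_character m y"
  have "residue_to_circle m (x i) = residue_to_circle m (y i)"
    using fun_cong[OF eq, of "residue_single m i 1"] residue_single_closed[OF m]
    by (simp add: L_character_def residue_pairing_single_left[OF m])
  then show "x i = y i"
    using xy m by (simp add: residue_to_circle_eq_iff carrier_K_group)
qed

text \<open>On finitely supported elements the pairing is symmetric, so injectivity follows from that of
  \<open>L_character\<close>.\<close>
lemma inj_on_K_character:
  assumes m: "m > 0"
  shows "inj_on (K_character m) (carrier (L_group m))"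
proof (rule inj_onI)
  fix a b
  assume ab: "a \<in> carrier (L_group m)" "b \<in> carrier (L_group m)"
    and eq: "K_character m a = K_character m b"
  have LK: "x \<in> carrier (K_group m)" if "x \<in> carrier (L_group m)" for x
    using that m by (simp add: carrier_L_group)
  have "L_character m a = L_character m b"
    unfolding L_character_def
  proof (rule restrict_ext)
    fix x
    assume x: "x \<in> carrier (L_group m)"
    show "residue_to_circle m (pairing m x a) = residue_to_circle m (pairing m x b)"
      using fun_cong[OF eq, of x] LK[OF x]
      unfolding pairing_sym[OF m x ab(1)] pairing_sym[OF m x ab(2)] by (simp add: K_character_def)
  qed
  then show "a = b"
    by (rule inj_onD[OF inj_on_L_character[OF m]]) (use ab LK in auto)
qed

lemma bij_betw_L_character:
  assumes m: "m > 0"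
  shows "bij_betw (L_character m) (carrier (K_group m)) (carrier (dual_group (L_group m) (L_topology m)))"
  unfolding bij_betw_def
proof (intro conjI equalityI subsetI)
  fix h
  assume "h \<in> carrier (dual_group (L_group m) (L_topology m))"
  then have ext: "h \<in> extensional (carrier (L_group m))" and hom: "h \<in> hom (L_group m) circle_group"
    by (auto simp: dual_group_def)
  obtain x where x: "x \<in> carrier (K_group m)" "\<And>a. a \<in> carrier (L_group m) \<Longrightarrow> h a = L_character m x a"
    using hom_L_eq_L_character[OF m hom] by blast
  have "h = L_character m x"
    by (rule extensionalityI[OF ext]) (simp_all add: x(2), simp add: L_character_def)
  with x show "h \<in> L_character m ` carrier (K_group m)" by blast
qed (use m inj_on_L_character L_character_in_dual in auto)

lemma bij_betw_K_character:
  assumes m: "m > 0"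
  shows "bij_betw (K_character m) (carrier (L_group m)) (carrier (dual_group (K_group m) (K_topology m)))"
  unfolding bij_betw_def
proof (intro conjI equalityI subsetI)
  fix h
  assume "h \<in> carrier (dual_group (K_group m) (K_topology m))"
  then have ext: "h \<in> extensional (carrier (K_group m))" and hom: "h \<in> hom (K_group m) circle_group"
    and cont: "continuous_map (K_topology m) circle_topology h"
    by (auto simp: dual_group_def)
  obtain a where a: "a \<in> carrier (L_group m)" "\<And>x. x \<in> carrier (K_group m) \<Longrightarrow> h x = K_character m a x"
    using hom_K_eq_K_character[OF m hom cont] by blast
  have "h = K_character m a"
    by (rule extensionalityI[OF ext]) (simp_all add: a(2), simp add: K_character_def)
  with a show "h \<in> K_character m ` carrier (L_group m)" by blast
qed (use m inj_on_K_character K_character_in_dual in auto)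

lemma L_character_iso:
  assumes m: "m > 0"
  shows "L_character m \<in> iso (K_group m) (dual_group (L_group m) (L_topology m))"
proof -
  have "L_character m \<in> hom (K_group m) (dual_group (L_group m) (L_topology m))"
  proof (rule homI)
    fix x y
    assume "x \<in> carrier (K_group m)" "y \<in> carrier (K_group m)"
    then show "L_character m (x \<otimes>\<^bsub>K_group m\<^esub> y) =
        L_character m x \<otimes>\<^bsub>dual_group (L_group m) (L_topology m)\<^esub> L_character m y"
      using m unfolding L_character_def dual_group_def
      by (simp add: residue_pairing_mult_right cong: restrict_cong)
  qed (rule L_character_in_dual[OF m])
  with bij_betw_L_character[OF m] show ?thesis
    by (simp add: iso_def)
qed

lemma K_character_iso:
  assumes m: "m > 0"
  shows "K_character m \<in> iso (L_group m) (dual_group (K_group m) (K_topology m))"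
proof -
  have "K_character m \<in> hom (L_group m) (dual_group (K_group m) (K_topology m))"
  proof (rule homI)
    fix a b
    assume "a \<in> carrier (L_group m)" "b \<in> carrier (L_group m)"
    then show "K_character m (a \<otimes>\<^bsub>L_group m\<^esub> b) =
        K_character m a \<otimes>\<^bsub>dual_group (K_group m) (K_topology m)\<^esub> K_character m b"
      using m unfolding K_character_def dual_group_def
      by (simp add: residue_pairing_mult_left cong: restrict_cong)
  qed (rule K_character_in_dual[OF m])
  with bij_betw_K_character[OF m] show ?thesis
    by (simp add: iso_def)
qed


section \<open>The compact-open topologies\<close>

lemma topspace_dual_topology: "topspace (dual_topology G X) = carrier (dual_group G X)"
proof -
  have "UNIV \<in> {{\<theta>. \<theta> ` C \<subseteq> U} | C U. compactin X C \<and> openin circle_topology U}"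
    by (auto intro!: exI[of _ "{}"])
  then show ?thesis
    by (auto simp: dual_topology_def topology_generated_by_topspace)
qed

lemma openin_dual_topology:
  assumes "compactin X C" "openin circle_topology U"
  shows "openin (dual_topology G X) {\<theta> \<in> carrier (dual_group G X). \<theta> ` C \<subseteq> U}"
proof -
  have "openin (topology_generated_by
      {{\<theta>. \<theta> ` C \<subseteq> U} | C U. compactin X C \<and> openin circle_topology U}) {\<theta>. \<theta> ` C \<subseteq> U}"
    using assms by (intro topology_generated_by_Basis) auto
  then show ?thesis
    by (auto simp: dual_topology_def openin_subtopology)
qed

lemma continuous_map_dual_topology:
  assumes f: "f \<in> topspace Y \<rightarrow> carrier (dual_group G X)"
    and sub: "\<And>C U. compactin X C \<Longrightarrow> openin circle_topology U \<Longrightarrow>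
      openin Y {y \<in> topspace Y. f y ` C \<subseteq> U}"
  shows "continuous_map Y (dual_topology G X) f"
  unfolding dual_topology_def continuous_map_in_subtopology
proof (intro conjI continuous_on_generated_topo)
  fix V
  assume "V \<in> {{\<theta>. \<theta> ` C \<subseteq> U} | C U. compactin X C \<and> openin circle_topology U}"
  then obtain C U where "compactin X C" "openin circle_topology U" "V = {\<theta>. \<theta> ` C \<subseteq> U}"
    by blast
  moreover have "f -` {\<theta>. \<theta> ` C \<subseteq> U} \<inter> topspace Y = {y \<in> topspace Y. f y ` C \<subseteq> U}"
    by auto
  ultimately show "openin Y (f -` V \<inter> topspace Y)"
    using sub by simp
next
  have "UNIV \<in> {{\<theta>. \<theta> ` C \<subseteq> U} | C U. compactin X C \<and> openin circle_topology U}"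
    by (auto intro!: exI[of _ "{}"])
  then show "f ` topspace Y \<subseteq> \<Union> {{\<theta>. \<theta> ` C \<subseteq> U} | C U. compactin X C \<and> openin circle_topology U}"
    by blast
qed (use f in auto)

text \<open>Two characters differ at the generator of some position \<open>i\<close>. Evaluation there separates them, as the arcs
  around the two values have no common point that a character can attain.\<close>
lemma Hausdorff_space_dual_L:
  assumes m: "m > 0"
  shows "Hausdorff_space (dual_topology (L_group m) (L_topology m))"
  unfolding Hausdorff_space_def topspace_dual_topology
proof (intro allI impI, elim conjE)
  let ?D = "carrier (dual_group (L_group m) (L_topology m))"
  fix \<theta> \<eta>
  assume "\<theta> \<in> ?D" "\<eta> \<in> ?D" and ne: "\<theta> \<noteq> \<eta>"
  then have "\<theta> \<in> L_character m ` carrier (K_group m)" "\<eta> \<in> L_character m ` carrier (K_group m)"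
    by (simp_all add: bij_betw_imp_surj_on[OF bij_betw_L_character[OF m]])
  then obtain x y where x: "x \<in> carrier (K_group m)" "\<theta> = L_character m x"
    and y: "y \<in> carrier (K_group m)" "\<eta> = L_character m y"
    by blast
  with ne have "x \<noteq> y" by blast
  then obtain i where i: "x i \<noteq> y i" by (auto simp: fun_eq_iff)
  let ?s = "residue_single m i 1"
  let ?U = "\<lambda>k. {\<theta> \<in> ?D. \<theta> ` {?s} \<subseteq> residue_arc m k}"
  have s: "?s \<in> carrier (L_group m)"
    by (rule residue_single_closed[OF m])
  have at: "L_character m z ?s \<in> residue_arc m k \<longleftrightarrow> z i mod int m = k mod int m" for z k
    using s m by (simp add: L_character_def residue_pairing_single_left residue_in_arc_iff)
  have op: "openin (dual_topology (L_group m) (L_topology m)) (?U k)" for k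
    using s by (intro openin_dual_topology openin_residue_arc) (simp add: topspace_L)
  have "disjnt (?U (x i)) (?U (y i))"
  proof -
    have False if \<theta>: "\<theta> \<in> ?U (x i)" "\<theta> \<in> ?U (y i)" for \<theta>
    proof -
      obtain z where "\<theta> = L_character m z"
        using \<theta> bij_betw_L_character[OF m] by (auto simp: bij_betw_def)
      with \<theta> have "x i mod int m = y i mod int m"
        by (simp add: at)
      with i x y m show False
        by (simp add: carrier_K_group)
    qed
    then show ?thesis by (auto simp: disjnt_def)
  qed
  moreover have "\<theta> \<in> ?U (x i)" "\<eta> \<in> ?U (y i)"
    using \<open>\<theta> \<in> ?D\<close> \<open>\<eta> \<in> ?D\<close> x y by (auto simp: at)
  ultimately show "\<exists>U V. openin (dual_topology (L_group m) (L_topology m)) U \<and>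
      openin (dual_topology (L_group m) (L_topology m)) V \<and> \<theta> \<in> U \<and> \<eta> \<in> V \<and> disjnt U V"
    using op by blast
qed

text \<open>A compact subset of the discrete group \<open>L\<close> is finite, so continuity amounts to continuity of
  finitely many evaluations, and the evaluation at \<open>a\<close> is the character \<open>K_character m a\<close> of \<open>K\<close>.
  Compactness of \<open>K\<close> makes the inverse continuous.\<close>
lemma L_character_homeomorphic:
  assumes m: "m > 0"
  shows "homeomorphic_map (K_topology m) (dual_topology (L_group m) (L_topology m)) (L_character m)"
proof (rule continuous_imp_homeomorphic_map)
  show "continuous_map (K_topology m) (dual_topology (L_group m) (L_topology m)) (L_character m)"
  proof (rule continuous_map_dual_topology)
    fix C U
    assume C: "compactin (L_topology m) C" and U: "openin circle_topology U"
    have fin: "finite C" and CL: "C \<subseteq> carrier (L_group m)"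
      using C by (auto simp: L_topology_def compactin_discrete_topology)
    have "openin (K_topology m) {x \<in> topspace (K_topology m). \<forall>a\<in>C. K_character m a x \<in> U}"
      using fin CL
    proof induction
      case (insert a C)
      have "continuous_map (K_topology m) circle_topology (K_character m a)"
        using K_character_in_dual[OF m, of a] insert.prems by (auto simp: dual_group_def)
      then have "openin (K_topology m) {x \<in> topspace (K_topology m). K_character m a x \<in> U}"
        using U by (rule openin_continuous_map_preimage)
      from openin_Int[OF this insert.IH] insert.prems show ?case
        by (auto elim!: rev_iffD1[where P = "openin _ _"] intro!: arg_cong[where f = "openin _"])
    qed simp
    moreover have "{x \<in> topspace (K_topology m). L_character m x ` C \<subseteq> U} =
        {x \<in> topspace (K_topology m). \<forall>a\<in>C. K_character m a x \<in> U}"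
      using CL by (auto simp: L_character_def K_character_def topspace_K subset_iff)
    ultimately show "openin (K_topology m) {x \<in> topspace (K_topology m). L_character m x ` C \<subseteq> U}"
      by simp
  qed (use L_character_in_dual[OF m] in \<open>auto simp: topspace_K\<close>)
qed (use m bij_betw_L_character[OF m] in \<open>auto simp: compact_space_K Hausdorff_space_dual_L
    topspace_K topspace_dual_topology bij_betw_def\<close>)

text \<open>The level set of \<open>pairing m a\<close> at \<open>v\<close> is closed in \<open>K\<close>, hence compact. A character that maps it into the
  arc around \<open>e v\<close>, for every residue \<open>v\<close>, agrees with \<open>K_character m a\<close> everywhere. These
  finitely many subbasic open conditions thus cut out a single character.\<close>
lemma dual_topology_K_discrete:
  assumes m: "m > 0"
  shows "dual_topology (K_group m) (K_topology m) =
    discrete_topology (carrier (dual_group (K_group m) (K_topology m)))"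
proof -
  let ?D = "carrier (dual_group (K_group m) (K_topology m))"
  have "openin (dual_topology (K_group m) (K_topology m)) {\<theta>}" if \<theta>: "\<theta> \<in> ?D" for \<theta>
  proof -
    obtain a where a: "a \<in> carrier (L_group m)" "\<theta> = K_character m a"
      using \<theta> bij_betw_K_character[OF m] by (auto simp: bij_betw_def)
    define C where "C = (\<lambda>v. {x \<in> topspace (K_topology m). pairing m a x \<in> {v}})"
    define N where "N = (\<lambda>v. {\<eta> \<in> ?D. \<eta> ` C v \<subseteq> residue_arc m v})"
    have "closedin (K_topology m) (C v)" if "v \<in> {0..<int m}" for v
      unfolding C_def using that
      by (intro closedin_continuous_map_preimage[OF continuous_map_pairing[OF m a(1)]]) simp
    then have "openin (dual_topology (K_group m) (K_topology m)) (N v)" if "v \<in> {0..<int m}" for v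
      unfolding N_def using that m
      by (intro openin_dual_topology openin_residue_arc closedin_compact_space compact_space_K)
    then have "openin (dual_topology (K_group m) (K_topology m)) (\<Inter>v\<in>{0..<int m}. N v)"
      using m by (intro openin_Inter) auto
    moreover have "(\<Inter>v\<in>{0..<int m}. N v) = {\<theta>}"
    proof (intro equalityI subsetI)
      fix \<eta>
      assume \<eta>: "\<eta> \<in> (\<Inter>v\<in>{0..<int m}. N v)"
      then have "\<eta> \<in> ?D"
        using m by (force simp: N_def)
      then obtain b where b: "b \<in> carrier (L_group m)" "\<eta> = K_character m b"
        using bij_betw_K_character[OF m] by (auto simp: bij_betw_def)
      have "K_character m b x = K_character m a x" if x: "x \<in> carrier (K_group m)" for x
      proof -
        have "pairing m a x \<in> {0..<int m}"
          using m by (simp add: pairing_def)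
        with \<eta> have "\<eta> ` C (pairing m a x) \<subseteq> residue_arc m (pairing m a x)"
          by (auto simp: N_def)
        moreover have "x \<in> C (pairing m a x)"
          using x by (simp add: C_def topspace_K)
        ultimately have "residue_to_circle m (pairing m b x) \<in> residue_arc m (pairing m a x)"
          using x b by (auto simp: K_character_def)
        then show ?thesis
          using x m by (simp add: residue_in_arc_iff residue_to_circle_eq_iff K_character_def)
      qed
      then show "\<eta> \<in> {\<theta>}"
        using a b by (auto simp: K_character_def fun_eq_iff)
    next
      fix \<eta>
      assume "\<eta> \<in> {\<theta>}"
      then show "\<eta> \<in> (\<Inter>v\<in>{0..<int m}. N v)"
        using \<theta> a m by (auto simp: N_def C_def K_character_def topspace_K residue_in_arc_iff)
    qed
    ultimately show ?thesis by simp
  qed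
  then show ?thesis
    using discrete_topology_unique[of ?D] topspace_dual_topology by metis
qed

lemma K_character_homeomorphic:
  assumes m: "m > 0"
  shows "homeomorphic_map (L_topology m) (dual_topology (K_group m) (K_topology m)) (K_character m)"
  using bij_betw_K_character[OF m]
  by (intro bijective_open_imp_homeomorphic_map)
    (auto simp: dual_topology_K_discrete[OF m] L_topology_def open_map_def bij_betw_def)


section \<open>The dual automata\<close>

text \<open>Since \<open>\<iota>\<close> is a bijection, transporting \<open>\<psi>\<close> along it can be checked on the characters \<open>\<iota> x\<close>.\<close>
lemma dual_map_eq_identified_map:
  assumes bij: "bij_betw \<iota> A (carrier (dual_group G X))"
    and eq: "\<And>x. x \<in> A \<Longrightarrow> compose (carrier G) (\<iota> x) \<phi> = \<iota> (\<psi> x)"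
  shows "dual_map G X \<phi> = identified_map A (carrier (dual_group G X)) \<iota> \<psi>"
proof -
  have "compose (carrier G) \<theta> \<phi> = \<iota> (\<psi> (inv_into A \<iota> \<theta>))"
    if "\<theta> \<in> carrier (dual_group G X)" for \<theta>
    using eq[of "inv_into A \<iota> \<theta>"] bij that
    by (simp add: bij_betw_def inv_into_into f_inv_into_f)
  then show ?thesis
    by (auto simp: dual_map_def identified_map_def)
qed

lemma dual_finitary_linear_CA:
  assumes m: "m > 0" and l: "l \<in> carrier (L_group m)"
  shows "dual_map (L_group m) (L_topology m) (finitary_linear_CA m l) =
    identified_map (carrier (K_group m)) (carrier (dual_group (L_group m) (L_topology m)))
      (L_character m) (linear_CA m (reflect l))"
proof (rule dual_map_eq_identified_map[OF bij_betw_L_character[OF m]])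
  fix x
  assume "x \<in> carrier (K_group m)"
  then show "compose (carrier (L_group m)) (L_character m x) (finitary_linear_CA m l) =
      L_character m (linear_CA m (reflect l) x)"
    using m l unfolding compose_def L_character_def
    by (intro restrict_ext) (simp add: finitary_linear_CA_closed pairing_finitary_linear_CA)
qed

lemma dual_linear_CA:
  assumes m: "m > 0" and l: "l \<in> carrier (L_group m)"
  shows "dual_map (K_group m) (K_topology m) (linear_CA m l) =
    identified_map (carrier (L_group m)) (carrier (dual_group (K_group m) (K_topology m)))
      (K_character m) (finitary_linear_CA m (reflect l))"
proof (rule dual_map_eq_identified_map[OF bij_betw_K_character[OF m]])
  fix a
  assume a: "a \<in> carrier (L_group m)"
  have "reflect (reflect l) = l"
    by (simp add: reflect_def)
  then have "pairing m (finitary_linear_CA m (reflect l) a) x = pairing m a (linear_CA m l x)"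
    if "x \<in> carrier (K_group m)" for x
    using pairing_finitary_linear_CA[OF m reflect_closed[OF m l] a that] by simp
  then show "compose (carrier (K_group m)) (K_character m a) (linear_CA m l) =
      K_character m (finitary_linear_CA m (reflect l) a)"
    using m unfolding compose_def K_character_def
    by (intro restrict_ext) (simp add: linear_CA_closed)
qed

theorem theorem1p9:
  fixes m :: nat and l :: "int \<Rightarrow> int"
  assumes "m > 0" and "l \<in> carrier (L_group m)"
  shows
    "topological_group_iso (K_group m) (K_topology m)
       (dual_group (L_group m) (L_topology m)) (dual_topology (L_group m) (L_topology m))
       (L_character m) \<and>
     topological_group_iso (L_group m) (L_topology m)
       (dual_group (K_group m) (K_topology m)) (dual_topology (K_group m) (K_topology m))
       (K_character m) \<and>
     dual_map (L_group m) (L_topology m) (finitary_linear_CA m l) =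
       identified_map (carrier (K_group m)) (carrier (dual_group (L_group m) (L_topology m)))
         (L_character m) (linear_CA m (reflect l)) \<and>
     dual_map (K_group m) (K_topology m) (linear_CA m l) =
       identified_map (carrier (L_group m)) (carrier (dual_group (K_group m) (K_topology m)))
         (K_character m) (finitary_linear_CA m (reflect l)) \<and>
     (reflect l = l \<longrightarrow>
       dual_map (L_group m) (L_topology m) (finitary_linear_CA m l) =
         identified_map (carrier (K_group m)) (carrier (dual_group (L_group m) (L_topology m)))
           (L_character m) (linear_CA m l) \<and>
       dual_map (K_group m) (K_topology m) (linear_CA m l) =
         identified_map (carrier (L_group m)) (carrier (dual_group (K_group m) (K_topology m)))
           (K_character m) (finitary_linear_CA m l))"
  using assms L_character_iso L_character_homeomorphic K_character_iso K_character_homeomorphic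
    dual_finitary_linear_CA[OF assms] dual_linear_CA[OF assms]
  by (simp add: topological_group_iso_def)

end
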